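(* Let $n\in\mathbb{N}$ and $c>0$. The unique negative eigenvalue of $\Delta^2-c\,\delta_n$ on $\ell^2(\mathbb{N})$ is $$\lambda_n(c)=-\frac{(1-r^2)^4}{r^2(1+r^2)^2},$$ where $r$ is the unique solution in $(0,1)$ of the equation $$\frac{r^2}{1-r^2}\sum_{j=0}^{n-1}r^{2j}\,U_{2j}\!\left(\frac{2r}{1+r^2}\right)=\frac1c .$$ In particular, for $n=1$, $$\lambda_1(c)=-\frac{c^4}{(c+1)(c+2)^2}.$$ Moreover, for every $n\ge2$, $$\lambda_n(c)=-\frac{n^8c^4}{4}\left(1-\frac{2n(4n^2-1)}{3}\,c+\mathcal{O}(c^2)\right),\qquad c\to0^+,$$ $$\lambda_n(c)=-c\left(1-\frac6c+\mathcal{O}\!\left(\frac1{c^2}\right)\right),\qquad c\to\infty.$$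
   Context: $\mathbb{N}=\{1,2,3,\dots\}$. The discrete Laplacian on the half line is the bounded self-adjoint operator $-\Delta$ on $\ell^2(\mathbb{N})$ given by $(-\Delta u)_n := -u_{n-1}+2u_n-u_{n+1}$ for $n\in\mathbb{N}$, with the convention $u_0:=0$. The discrete bilaplacian is $\Delta^2=(-\Delta)^2$. Let $\{e_n\}_{n\in\mathbb{N}}$ be the standard basis of $\ell^2(\mathbb{N})$ and $\delta_n:=\langle e_n,\cdot\,\rangle e_n$. It is known that for every $n\in\mathbb{N}$ and $c>0$ the operator $\Delta^2-c\,\delta_n$ has a unique negative eigenvalue. $U_k$ denotes the $k$-th Chebyshev polynomial of the second kind: $U_0(x)=1$, $U_1(x)=2x$, $U_{k+1}(x)=2xU_k(x)-U_{k-1}(x)$. *)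

theory Defs
  imports "HOL-Analysis.Analysis" "HOL-Library.Landau_Symbols"
    "HOL-Computational_Algebra.Polynomial"
begin

text \<open>
  Sequences indexed by \<open>{1, 2, 3, \<dots>}\<close> are functions on \<^typ>\<open>nat\<close> whose value at \<open>0\<close> is \<open>0\<close>.
  This makes the boundary convention \<open>u\<^sub>0 = 0\<close> part of the space.
\<close>

definition ell2 :: "(nat \<Rightarrow> complex) set" where
  "ell2 = {u. u 0 = 0 \<and> summable (\<lambda>n. (cmod (u n))\<^sup>2)}"

definition ell2_inner :: "(nat \<Rightarrow> complex) \<Rightarrow> (nat \<Rightarrow> complex) \<Rightarrow> complex" where
  "ell2_inner u v = (\<Sum>n. cnj (u n) * v n)"

definition ell2_basis :: "nat \<Rightarrow> nat \<Rightarrow> complex" where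
  "ell2_basis n = (\<lambda>k. if k = n then 1 else 0)"

text \<open>This is \<open>-\<Delta>\<close>; the value \<open>0\<close> at index \<open>0\<close> keeps the result in the space of sequences above.\<close>

definition neg_laplacian :: "(nat \<Rightarrow> complex) \<Rightarrow> nat \<Rightarrow> complex" where
  "neg_laplacian u = (\<lambda>n. if n = 0 then 0 else - u (n - 1) + 2 * u n - u (n + 1))"

definition bilaplacian :: "(nat \<Rightarrow> complex) \<Rightarrow> nat \<Rightarrow> complex" where
  "bilaplacian u = neg_laplacian (neg_laplacian u)"

definition delta_op :: "nat \<Rightarrow> (nat \<Rightarrow> complex) \<Rightarrow> nat \<Rightarrow> complex" where
  "delta_op n u = (\<lambda>k. ell2_inner (ell2_basis n) u * ell2_basis n k)"

definition perturbed :: "nat \<Rightarrow> real \<Rightarrow> (nat \<Rightarrow> complex) \<Rightarrow> nat \<Rightarrow> complex" where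
  "perturbed n c u = (\<lambda>k. bilaplacian u k - of_real c * delta_op n u k)"

definition is_eigenvalue ::
    "((nat \<Rightarrow> complex) \<Rightarrow> nat \<Rightarrow> complex) \<Rightarrow> complex \<Rightarrow> bool" where
  "is_eigenvalue A \<mu> \<longleftrightarrow> (\<exists>u\<in>ell2. u \<noteq> (\<lambda>k. 0) \<and> A u = (\<lambda>k. \<mu> * u k))"

definition is_negative_eigenvalue :: "nat \<Rightarrow> real \<Rightarrow> real \<Rightarrow> bool" where
  "is_negative_eigenvalue n c \<mu> \<longleftrightarrow> \<mu> < 0 \<and> is_eigenvalue (perturbed n c) (of_real \<mu>)"

definition neg_eigenvalue :: "nat \<Rightarrow> real \<Rightarrow> real" where
  "neg_eigenvalue n c = (THE \<mu>. is_negative_eigenvalue n c \<mu>)"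

fun chebyshev_U :: "nat \<Rightarrow> real poly" where
  "chebyshev_U 0 = 1"
| "chebyshev_U (Suc 0) = [:0, 2:]"
| "chebyshev_U (Suc (Suc k)) = [:0, 2:] * chebyshev_U (Suc k) - chebyshev_U k"

definition char_eq :: "nat \<Rightarrow> real \<Rightarrow> real \<Rightarrow> bool" where
  "char_eq n c r \<longleftrightarrow>
     r\<^sup>2 / (1 - r\<^sup>2) * (\<Sum>j<n. r ^ (2 * j) * poly (chebyshev_U (2 * j)) (2 * r / (1 + r\<^sup>2))) = 1 / c"

end

theory Submission
  imports Defs "HOL-Real_Asymp.Real_Asymp"
begin

text \<open>
  Everything rests on two facts about \<open>\<Delta>\<^sup>2 - c \<delta>\<^sub>n\<close>.

  A solution \<open>r\<close> of the characteristic equation yields an explicit eigenvector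
  (\<open>char_eq_imp_negative_eigenvalue\<close>). For \<open>\<mu> = - w\<^sup>2\<close> the operator \<open>\<Delta>\<^sup>2 - \<mu>\<close> factors as
  \<open>(- \<Delta> - \<i> w) (- \<Delta> + \<i> w)\<close>, hence \<open>(\<Delta>\<^sup>2 - \<mu>)\<^sup>-\<^sup>1 e\<^sub>n\<close> is \<open>1 / w\<close> times the imaginary part of the
  Green function of the second-order operator at \<open>\<i> w\<close>. That function is elementary, its value at
  \<open>n\<close> is a geometric sum of odd powers of a number \<open>z\<close> of modulus \<open>r\<close>, and the imaginary parts of
  the powers of \<open>z\<close> are multiples of Chebyshev polynomials in \<open>2 r / (1 + r\<^sup>2)\<close>, the cosine of its argument.

  There is at most one negative eigenvalue (\<open>negative_eigenvalue_unique\<close>), because a rank-one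
  perturbation of a nonnegative form is negative definite on no plane.

  The rest is real analysis. The intermediate value theorem provides a solution \<open>r\<close>; two solutions
  would belong to the same eigenvalue, which is a strictly monotone function of \<open>r\<close>, so the solution
  is unique. With \<open>q = r\<^sup>2\<close> the characteristic equation reads \<open>c q S(q) = 1 - q\<close> for the Chebyshev
  sum \<open>S\<close>. It determines \<open>c\<close> explicitly as a function of \<open>q\<close>, so both expansions are obtained
  by expanding explicit functions at \<open>q = 1\<close> (small \<open>c\<close>) and at \<open>q = 0\<close> (large \<open>c\<close>), together with
  the a priori bounds \<open>1 - q = O(c)\<close> and \<open>q = O(1 / c)\<close>.
\<close>

section \<open>The half-line Laplacian on square-summable sequences\<close>

lemma neg_laplacian_lincomb:
  "neg_laplacian (\<lambda>k. a * u k + b * v k) = (\<lambda>k. a * neg_laplacian u k + b * neg_laplacian v k)"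
  by (rule ext) (simp add: neg_laplacian_def algebra_simps)

lemma bilaplacian_lincomb:
  "bilaplacian (\<lambda>k. a * u k + b * v k) = (\<lambda>k. a * bilaplacian u k + b * bilaplacian v k)"
  by (simp add: bilaplacian_def neg_laplacian_lincomb)

lemma perturbed_apply:
  "perturbed n c u k = bilaplacian u k - of_real c * (if k = n then u n else 0)"
proof -
  have "ell2_inner (ell2_basis n) u = (\<Sum>j\<in>{n}. cnj (ell2_basis n j) * u j)"
    unfolding ell2_inner_def by (rule suminf_finite) (auto simp: ell2_basis_def)
  then show ?thesis
    by (simp add: perturbed_def delta_op_def ell2_basis_def)
qed

lemma summable_norm_square_lincomb:
  fixes u v :: "nat \<Rightarrow> complex"
  assumes "summable (\<lambda>k. (cmod (u k))\<^sup>2)" "summable (\<lambda>k. (cmod (v k))\<^sup>2)"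
  shows "summable (\<lambda>k. (cmod (a * u k + b * v k))\<^sup>2)"
proof (rule summable_comparison_test')
  show "summable (\<lambda>k. 2 * (cmod a)\<^sup>2 * (cmod (u k))\<^sup>2 + 2 * (cmod b)\<^sup>2 * (cmod (v k))\<^sup>2)"
    by (intro summable_add summable_mult assms)
  show "norm ((cmod (a * u k + b * v k))\<^sup>2)
      \<le> 2 * (cmod a)\<^sup>2 * (cmod (u k))\<^sup>2 + 2 * (cmod b)\<^sup>2 * (cmod (v k))\<^sup>2" for k
  proof -
    have "(cmod (a * u k + b * v k))\<^sup>2 \<le> (cmod (a * u k) + cmod (b * v k))\<^sup>2"
      by (intro power_mono norm_triangle_ineq) simp
    also have "\<dots> \<le> 2 * (cmod (a * u k))\<^sup>2 + 2 * (cmod (b * v k))\<^sup>2"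
      using sum_squares_bound[of "cmod (a * u k)" "cmod (b * v k)"] by (simp add: power2_sum)
    finally show ?thesis by (simp add: norm_mult power_mult_distrib)
  qed
qed

lemma ell2_lincomb:
  assumes "u \<in> ell2" "v \<in> ell2"
  shows "(\<lambda>k. a * u k + b * v k) \<in> ell2"
  using assms summable_norm_square_lincomb[of u v a b] by (simp add: ell2_def)

lemma neg_laplacian_in_ell2:
  assumes "u \<in> ell2"
  shows "neg_laplacian u \<in> ell2"
proof -
  have s: "summable (\<lambda>k. (cmod (u k))\<^sup>2)" using assms by (simp add: ell2_def)
  have s1: "summable (\<lambda>k. (cmod (u (Suc k)))\<^sup>2)"
    using s by (subst summable_Suc_iff)
  have s2: "summable (\<lambda>k. (cmod (u (Suc (Suc k))))\<^sup>2)"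
    using s1 by (subst (asm) summable_Suc_iff[symmetric])
  have "summable (\<lambda>k. (cmod (neg_laplacian u (Suc k)))\<^sup>2)"
    using summable_norm_square_lincomb
        [OF summable_norm_square_lincomb[OF s s1, of "-1" 2] s2, of 1 "-1"]
    by (simp add: neg_laplacian_def)
  then have "summable (\<lambda>k. (cmod (neg_laplacian u k))\<^sup>2)"
    by (subst (asm) summable_Suc_iff)
  then show ?thesis by (simp add: ell2_def neg_laplacian_def)
qed

lemma summable_ell2_inner:
  assumes "u \<in> ell2" "v \<in> ell2"
  shows "summable (\<lambda>k. cnj (u k) * v k)"
proof (rule summable_comparison_test')
  show "summable (\<lambda>k. (cmod (u k))\<^sup>2 + (cmod (v k))\<^sup>2)"
    using assms by (intro summable_add) (auto simp: ell2_def)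
  show "norm (cnj (u k) * v k) \<le> (cmod (u k))\<^sup>2 + (cmod (v k))\<^sup>2" for k
    using sum_squares_bound[of "cmod (u k)" "cmod (v k)"]
      mult_nonneg_nonneg[OF norm_ge_zero[of "u k"] norm_ge_zero[of "v k"]]
    by (simp only: norm_mult complex_mod_cnj)
qed

lemma ell2_tendsto_zero:
  assumes "u \<in> ell2"
  shows "u \<longlonglongrightarrow> 0"
proof -
  have "(\<lambda>k. (cmod (u k))\<^sup>2) \<longlonglongrightarrow> 0"
    using assms by (intro summable_LIMSEQ_zero) (simp add: ell2_def)
  then have "(\<lambda>k. sqrt ((cmod (u k))\<^sup>2)) \<longlonglongrightarrow> sqrt 0" by (rule tendsto_real_sqrt)
  then show ?thesis by (simp add: tendsto_norm_zero_iff)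
qed

text \<open>
  The discrete Green identity telescopes; the boundary term left at \<open>N\<close> vanishes in the limit,
  and the one at \<open>0\<close> vanishes because of the Dirichlet condition.
\<close>

lemma neg_laplacian_symmetric:
  assumes u: "u \<in> ell2" and v: "v \<in> ell2"
  shows "ell2_inner u (neg_laplacian v) = ell2_inner (neg_laplacian u) v"
proof -
  let ?d = "\<lambda>k. cnj (u k) * neg_laplacian v k - cnj (neg_laplacian u k) * v k"
  have zero: "u 0 = 0" "v 0 = 0" using assms by (auto simp: ell2_def)
  have "(\<Sum>k<Suc N. ?d k) = cnj (u (Suc N)) * v N - cnj (u N) * v (Suc N)" for N
    by (induction N) (auto simp: neg_laplacian_def zero algebra_simps)
  moreover have "(\<lambda>N. cnj (u (Suc N)) * v N - cnj (u N) * v (Suc N)) \<longlonglongrightarrow> cnj 0 * 0 - cnj 0 * 0"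
    using ell2_tendsto_zero[OF u] ell2_tendsto_zero[OF v]
    by (intro tendsto_intros LIMSEQ_Suc)
  ultimately have "(\<lambda>N. \<Sum>k<Suc N. ?d k) \<longlonglongrightarrow> 0" by simp
  then have "(\<lambda>N. \<Sum>k<N. ?d k) \<longlonglongrightarrow> 0" by (rule LIMSEQ_imp_Suc)
  then have "?d sums 0" by (simp add: sums_def)
  moreover have "?d sums (ell2_inner u (neg_laplacian v) - ell2_inner (neg_laplacian u) v)"
    unfolding ell2_inner_def
    by (intro sums_diff summable_sums summable_ell2_inner neg_laplacian_in_ell2 u v)
  ultimately show ?thesis using sums_unique2 by fastforce
qed

lemma ell2_inner_bilaplacian:
  assumes "u \<in> ell2" "v \<in> ell2"
  shows "ell2_inner u (bilaplacian v) = ell2_inner (neg_laplacian u) (neg_laplacian v)"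
  unfolding bilaplacian_def using assms by (intro neg_laplacian_symmetric neg_laplacian_in_ell2)

lemma ell2_inner_cnj:
  assumes "u \<in> ell2" "v \<in> ell2"
  shows "cnj (ell2_inner u v) = ell2_inner v u"
proof -
  have "(\<lambda>k. cnj (cnj (u k) * v k)) sums cnj (ell2_inner u v)"
    unfolding sums_cnj ell2_inner_def using assms by (intro summable_sums summable_ell2_inner)
  then show ?thesis by (simp add: ell2_inner_def mult.commute sums_iff)
qed

lemma ell2_inner_lincomb_right:
  assumes "u \<in> ell2" "v \<in> ell2" "w \<in> ell2"
  shows "ell2_inner w (\<lambda>k. a * u k + b * v k) = a * ell2_inner w u + b * ell2_inner w v"
proof -
  have "(\<lambda>k. a * (cnj (w k) * u k) + b * (cnj (w k) * v k)) sums
      (a * ell2_inner w u + b * ell2_inner w v)"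
    unfolding ell2_inner_def
    by (intro sums_add sums_mult summable_sums summable_ell2_inner assms)
  then show ?thesis by (simp add: ell2_inner_def sums_iff algebra_simps)
qed

lemma ell2_inner_self:
  assumes "u \<in> ell2"
  shows "ell2_inner u u = of_real (\<Sum>k. (cmod (u k))\<^sup>2)"
proof -
  have "ell2_inner u u = (\<Sum>k. of_real ((cmod (u k))\<^sup>2))"
    unfolding ell2_inner_def by (simp only: complex_norm_square mult.commute)
  also have "\<dots> = of_real (\<Sum>k. (cmod (u k))\<^sup>2)"
    using assms by (intro suminf_of_real[symmetric]) (simp add: ell2_def)
  finally show ?thesis .
qed

lemma ell2_norm_pos:
  assumes "u \<in> ell2" "u \<noteq> (\<lambda>k. 0)"
  shows "(\<Sum>k. (cmod (u k))\<^sup>2) > 0"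
proof -
  obtain k where "u k \<noteq> 0" using assms(2) by auto
  then show ?thesis using assms(1) by (intro suminf_pos2[of _ k]) (auto simp: ell2_def)
qed

section \<open>Uniqueness of the negative eigenvalue\<close>

text \<open>
  Eigenvectors \<open>u\<close>, \<open>v\<close> for distinct real eigenvalues are orthogonal. If both eigenvalues are
  negative, the quadratic form is negative definite on their span. The combination
  \<open>w = v\<^sub>n u - u\<^sub>n v\<close> vanishes at \<open>n\<close>, where the form reduces to the squared norm of the
  Laplacian of \<open>w\<close>; so \<open>w = 0\<close> and \<open>u\<^sub>n = 0\<close>, and the same argument then applies to \<open>u\<close> itself.
\<close>

lemma negative_eigenvalue_unique:
  assumes "n \<ge> 1" and "is_negative_eigenvalue n c \<nu>" "is_negative_eigenvalue n c \<mu>"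
  shows "\<nu> = \<mu>"
proof (rule ccontr)
  assume ne: "\<nu> \<noteq> \<mu>"
  obtain u where u: "u \<in> ell2" "u \<noteq> (\<lambda>k. 0)" "perturbed n c u = (\<lambda>k. of_real \<nu> * u k)"
    and neg1: "\<nu> < 0"
    using assms(2) unfolding is_negative_eigenvalue_def is_eigenvalue_def by blast
  obtain v where v: "v \<in> ell2" "v \<noteq> (\<lambda>k. 0)" "perturbed n c v = (\<lambda>k. of_real \<mu> * v k)"
    and neg2: "\<mu> < 0"
    using assms(3) unfolding is_negative_eigenvalue_def is_eigenvalue_def by blast
  define e where "e = ell2_basis n"
  have "summable (\<lambda>k. (cmod (e k))\<^sup>2)"
    by (rule summable_finite[of "{n}"]) (auto simp: e_def ell2_basis_def)
  then have e: "e \<in> ell2"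
    using assms(1) by (simp add: ell2_def e_def ell2_basis_def)
  have inner_e: "ell2_inner w e = cnj (w n)" for w
  proof -
    have "ell2_inner w e = (\<Sum>k\<in>{n}. cnj (w k) * e k)"
      unfolding ell2_inner_def by (rule suminf_finite) (auto simp: e_def ell2_basis_def)
    then show ?thesis by (simp add: e_def ell2_basis_def)
  qed
  have Lu: "bilaplacian u = (\<lambda>k. of_real \<nu> * u k + of_real c * u n * e k)"
    using fun_cong[OF u(3)] by (auto simp: perturbed_apply e_def ell2_basis_def algebra_simps)
  have Lv: "bilaplacian v = (\<lambda>k. of_real \<mu> * v k + of_real c * v n * e k)"
    using fun_cong[OF v(3)] by (auto simp: perturbed_apply e_def ell2_basis_def algebra_simps)
  have vu: "ell2_inner v u = 0"
  proof -
    have "ell2_inner v (bilaplacian u) = cnj (ell2_inner u (bilaplacian v))"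
      using u(1) v(1) by (simp add: ell2_inner_bilaplacian ell2_inner_cnj neg_laplacian_in_ell2)
    then have "of_real \<nu> * ell2_inner v u = of_real \<mu> * ell2_inner v u"
      unfolding Lu Lv using u(1) v(1) e
      by (simp add: ell2_inner_lincomb_right inner_e ell2_inner_cnj)
    then show ?thesis using ne by simp
  qed
  then have uv: "ell2_inner u v = 0" using ell2_inner_cnj[OF v(1) u(1)] by simp
  define U where "U = (\<Sum>k. (cmod (u k))\<^sup>2)"
  define V where "V = (\<Sum>k. (cmod (v k))\<^sup>2)"
  have U: "ell2_inner u u = of_real U" "U > 0" and V: "ell2_inner v v = of_real V" "V > 0"
    using u v ell2_inner_self ell2_norm_pos unfolding U_def V_def by auto
  define w where "w = (\<lambda>k. v n * u k + (- u n) * v k)"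
  have w: "w \<in> ell2" unfolding w_def using u(1) v(1) by (rule ell2_lincomb)
  have wu: "ell2_inner w u = cnj (v n) * of_real U"
    using ell2_inner_cnj[OF u(1) w, symmetric] ell2_inner_lincomb_right[OF u(1) v(1) u(1), of "v n" "- u n"]
    unfolding w_def[symmetric] by (simp add: uv U)
  have wv: "ell2_inner w v = - cnj (u n) * of_real V"
    using ell2_inner_cnj[OF v(1) w, symmetric] ell2_inner_lincomb_right[OF u(1) v(1) v(1), of "v n" "- u n"]
    unfolding w_def[symmetric] by (simp add: vu V)
  have "bilaplacian w = (\<lambda>k. (v n * of_real \<nu>) * u k + (- u n * of_real \<mu>) * v k)"
    unfolding w_def bilaplacian_lincomb Lu Lv by (simp add: algebra_simps)
  then have "ell2_inner w (bilaplacian w)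
      = v n * of_real \<nu> * ell2_inner w u + - u n * of_real \<mu> * ell2_inner w v"
    by (simp only: ell2_inner_lincomb_right[OF u(1) v(1) w])
  also have "\<dots> = of_real \<nu> * of_real U * (v n * cnj (v n)) + of_real \<mu> * of_real V * (u n * cnj (u n))"
    by (simp add: wu wv algebra_simps)
  also have "\<dots> = of_real (\<nu> * U * (cmod (v n))\<^sup>2 + \<mu> * V * (cmod (u n))\<^sup>2)"
    by (simp add: complex_norm_square[symmetric])
  finally have "of_real (\<nu> * U * (cmod (v n))\<^sup>2 + \<mu> * V * (cmod (u n))\<^sup>2)
      = (of_real (\<Sum>k. (cmod (neg_laplacian w k))\<^sup>2) :: complex)"
    using ell2_inner_bilaplacian[OF w w] ell2_inner_self[OF neg_laplacian_in_ell2[OF w]] by simp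
  then have form: "\<nu> * U * (cmod (v n))\<^sup>2 + \<mu> * V * (cmod (u n))\<^sup>2
      = (\<Sum>k. (cmod (neg_laplacian w k))\<^sup>2)"
    by (simp only: of_real_eq_iff)
  have "(\<Sum>k. (cmod (neg_laplacian w k))\<^sup>2) \<ge> 0"
    using neg_laplacian_in_ell2[OF w] by (intro suminf_nonneg) (auto simp: ell2_def)
  moreover have "\<nu> * U * (cmod (v n))\<^sup>2 \<le> 0"
    using neg1 U(2) by (simp add: mult_nonpos_nonneg mult_nonneg_nonneg mult_le_0_iff)
  moreover have "\<mu> * V * (cmod (u n))\<^sup>2 \<le> 0" "(\<mu> * V * (cmod (u n))\<^sup>2 = 0) = (u n = 0)"
    using neg2 V(2) by (simp_all add: mult_le_0_iff)
  ultimately have un: "u n = 0" using form by linarith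
  \<comment> \<open>Now \<open>u\<close> itself is an eigenvector of the nonnegative bilaplacian, which is absurd.\<close>
  have "ell2_inner u (bilaplacian u) = of_real (\<nu> * U)"
    using ell2_inner_lincomb_right[OF u(1) e u(1), of "of_real \<nu>" 0]
    by (simp add: Lu un U)
  then have "\<nu> * U = (\<Sum>k. (cmod (neg_laplacian u k))\<^sup>2)"
    using ell2_inner_bilaplacian[OF u(1) u(1)] ell2_inner_self[OF neg_laplacian_in_ell2[OF u(1)]]
    by (metis of_real_eq_iff)
  moreover have "(\<Sum>k. (cmod (neg_laplacian u k))\<^sup>2) \<ge> 0"
    using neg_laplacian_in_ell2[OF u(1)] by (intro suminf_nonneg) (auto simp: ell2_def)
  ultimately show False using mult_neg_pos[OF neg1 U(2)] by linarith
qed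

section \<open>The eigenvector\<close>

text \<open>
  Away from \<open>n\<close> every combination of the powers of \<open>z\<close> and \<open>1 / z\<close> is a generalised
  eigenvector of the Laplacian with eigenvalue \<open>2 - z - 1 / z\<close>; reflecting
  \<open>z ^ \<bar>m - n\<bar>\<close> at the origin enforces the Dirichlet condition. The kink at \<open>n\<close> produces the
  factor \<open>1 / z - z\<close> that is divided out.
\<close>

definition green :: "complex \<Rightarrow> nat \<Rightarrow> nat \<Rightarrow> complex" where
  "green z n m = ((if m \<le> n then z ^ (n - m) else z ^ (m - n)) - z ^ (m + n)) / (1 / z - z)"

lemma neg_laplacian_green:
  assumes z: "z \<noteq> 0" "z\<^sup>2 \<noteq> 1" and n: "n \<ge> 1"
  shows "neg_laplacian (green z n) = (\<lambda>m. (2 - z - 1 / z) * green z n m + ell2_basis n m)"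
proof (rule ext)
  fix m
  define N where "N = (\<lambda>m. (if m \<le> n then z ^ (n - m) else z ^ (m - n)) - z ^ (m + n))"
  define D where "D = 1 / z - z"
  have green: "green z n = (\<lambda>m. N m / D)"
    by (simp add: fun_eq_iff green_def N_def D_def)
  have d: "D \<noteq> 0" using z by (simp add: D_def field_simps power2_eq_square)
  have step: "z ^ Suc (Suc k) + z ^ k = (z + 1 / z) * z ^ Suc k" for k
    using z(1) by (simp add: field_simps)
  show "neg_laplacian (green z n) m = (2 - z - 1 / z) * green z n m + ell2_basis n m"
  proof (cases m)
    case 0
    then show ?thesis using n by (simp add: neg_laplacian_def green_def ell2_basis_def)
  next
    case (Suc p)
    have "N p + N (Suc (Suc p)) = (z + 1 / z) * N m - (if m = n then D else 0)"
    proof -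
      consider "m < n" | "m = n" | "m > n" by linarith
      then show ?thesis
      proof cases
        case 1
        then obtain k where "n = Suc (m + k)" using less_iff_Suc_add by auto
        then show ?thesis using Suc step[of k] step[of "p + n"]
          by (simp add: N_def D_def Suc_diff_le algebra_simps)
      next
        case 2
        then have n: "n = Suc p" "m = Suc p" using Suc by auto
        show ?thesis using step[of "p + Suc p"] z(1)
          by (simp add: N_def D_def n Suc_diff_le algebra_simps)
      next
        case 3
        then obtain k where "m = Suc (n + k)" using less_iff_Suc_add by auto
        then show ?thesis using Suc step[of k] step[of "p + n"]
          by (cases k) (simp_all add: N_def D_def Suc_diff_le algebra_simps)
      qed
    qed
    then have "- N p + 2 * N m - N (Suc (Suc p))
        = (2 - z - 1 / z) * N m + (if m = n then D else 0)"
      by (simp add: algebra_simps)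
    then have "(- N p + 2 * N m - N (Suc (Suc p))) / D
        = (2 - z - 1 / z) * (N m / D) + ell2_basis n m"
      using d by (simp only: add_divide_distrib times_divide_eq_right) (simp add: ell2_basis_def)
    then show ?thesis
      by (simp add: neg_laplacian_def green Suc diff_divide_distrib add_divide_distrib)
  qed
qed

lemma green_in_ell2:
  assumes "0 < cmod z" "cmod z < 1"
  shows "green z n \<in> ell2"
proof -
  let ?C = "(1 / cmod z ^ n + 1) / cmod (1 / z - z)"
  have bound: "cmod (green z n m) \<le> ?C * cmod z ^ m" for m
  proof -
    have "cmod (if m \<le> n then z ^ (n - m) else z ^ (m - n)) \<le> cmod z ^ m / cmod z ^ n"
    proof (cases "m \<le> n")
      case True
      have "cmod z ^ (n - m) * cmod z ^ n \<le> cmod z ^ m"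
        using assms True by (simp add: power_add[symmetric] power_decreasing)
      then show ?thesis using assms True by (simp add: norm_power field_simps)
    next
      case False
      then show ?thesis using assms by (simp add: norm_power norm_divide power_diff)
    qed
    moreover have "cmod (z ^ (m + n)) \<le> cmod z ^ m"
      using assms by (simp add: norm_power power_decreasing)
    ultimately have "cmod ((if m \<le> n then z ^ (n - m) else z ^ (m - n)) - z ^ (m + n))
        \<le> cmod z ^ m / cmod z ^ n + cmod z ^ m"
      by (meson add_mono norm_triangle_ineq4 order_trans)
    from divide_right_mono[OF this, of "cmod (1 / z - z)"] show ?thesis
      unfolding green_def norm_divide by (simp add: algebra_simps add_divide_distrib)
  qed
  have "summable (\<lambda>m. (cmod (green z n m))\<^sup>2)"
  proof (rule summable_comparison_test')
    show "summable (\<lambda>m. ?C\<^sup>2 * ((cmod z)\<^sup>2) ^ m)"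
      using assms by (intro summable_mult summable_geometric) (simp add: abs_square_less_1)
    show "norm ((cmod (green z n m))\<^sup>2) \<le> ?C\<^sup>2 * ((cmod z)\<^sup>2) ^ m" for m
    proof -
      have "(cmod (green z n m))\<^sup>2 \<le> (?C * cmod z ^ m)\<^sup>2"
        by (intro power_mono bound) simp
      also have "\<dots> = ?C\<^sup>2 * ((cmod z)\<^sup>2) ^ m"
        by (simp only: power_mult_distrib power_mult[symmetric] mult.commute)
      finally show ?thesis by simp
    qed
  qed
  then show ?thesis by (simp add: ell2_def green_def)
qed

lemma green_diagonal:
  assumes "z \<noteq> 0" "z\<^sup>2 \<noteq> 1"
  shows "green z n n = (\<Sum>j<n. z ^ (2 * j + 1))"
proof -
  have "1 - z ^ (n + n) = (1 - z\<^sup>2) * (\<Sum>j<n. (z\<^sup>2) ^ j)"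
    using one_diff_power_eq[of "z\<^sup>2" n] by (simp add: power_mult[symmetric] mult_2)
  moreover have "1 / z - z = (1 - z\<^sup>2) / z"
    using assms(1) by (simp add: field_simps power2_eq_square)
  ultimately have "green z n n = z * (\<Sum>j<n. (z\<^sup>2) ^ j)"
    using assms by (simp add: green_def)
  then show ?thesis by (simp add: sum_distrib_left power_mult)
qed

text \<open>For \<open>x = cos \<theta>\<close> and \<open>y = sin \<theta>\<close> this is the formula \<open>sin ((k + 1) \<theta>) = sin \<theta> U\<^sub>k (cos \<theta>)\<close>.\<close>

lemma Im_power_chebyshev:
  assumes "x\<^sup>2 + y\<^sup>2 = 1"
  shows "Im (Complex x y ^ Suc k) = y * poly (chebyshev_U k) x"
proof (induction k rule: chebyshev_U.induct)
  case (3 k)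
  have Im_lin: "Im (of_real a * v - w) = a * Im v - Im w" for a v w by simp
  have "Complex x y ^ Suc (Suc (Suc k)) = Complex x y ^ Suc k * (Complex x y)\<^sup>2"
    by (simp add: power2_eq_square)
  also have "(Complex x y)\<^sup>2 = of_real (2 * x) * Complex x y - 1"
    using assms by (simp add: complex_eq_iff power2_eq_square)
  finally have "Complex x y ^ Suc (Suc (Suc k))
      = of_real (2 * x) * Complex x y ^ Suc (Suc k) - Complex x y ^ Suc k"
    by (simp add: algebra_simps)
  then have "Im (Complex x y ^ Suc (Suc (Suc k)))
      = 2 * x * Im (Complex x y ^ Suc (Suc k)) - Im (Complex x y ^ Suc k)"
    by (simp only: Im_lin)
  then show ?case using 3 by (simp add: algebra_simps del: power_Suc)
qed (auto)

text \<open>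
  The sum in the characteristic equation as a function of \<open>q = r\<^sup>2\<close>, the variable in which the
  eigenvalue is a rational function.
\<close>

definition cheb_sum :: "nat \<Rightarrow> real \<Rightarrow> real" where
  "cheb_sum n q = (\<Sum>j<n. q ^ j * poly (chebyshev_U (2 * j)) (2 * sqrt q / (1 + q)))"

lemma char_eq_iff:
  assumes "0 < r" "r < 1" "c > 0"
  shows "char_eq n c r \<longleftrightarrow> c * r\<^sup>2 * cheb_sum n (r\<^sup>2) = 1 - r\<^sup>2"
proof -
  have "r\<^sup>2 < 1" using assms by (simp add: abs_square_less_1)
  then show ?thesis
    using assms by (simp add: char_eq_def cheb_sum_def power_mult[symmetric] field_simps)
qed

text \<open>The argument is \<open>r\<^sup>2\<close>.\<close>

definition eigenvalue_at :: "real \<Rightarrow> real" where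
  "eigenvalue_at q = - ((1 - q) ^ 4 / (q * (1 + q)\<^sup>2))"

text \<open>
  The equation \<open>(2 - z - 1 / z)\<^sup>2 = \<mu>\<close> with \<open>\<mu> < 0\<close> means that \<open>2 - z - 1 / z\<close> is purely
  imaginary, and for \<open>z = r (cos \<theta> + \<i> sin \<theta>)\<close> this says \<open>cos \<theta> = 2 r / (1 + r\<^sup>2)\<close>.
  Let \<open>\<zeta> = 2 - z - 1 / z\<close> and let \<open>G\<close> be the Green function of the Laplacian at \<open>\<zeta>\<close>. Since
  \<open>cnj \<zeta> = - \<zeta>\<close>, the sequence \<open>u = G - cnj G\<close> satisfies
  \<open>\<Delta>\<^sup>2 u = \<zeta>\<^sup>2 u + 2 \<zeta> e\<^sub>n\<close>. It is an eigenvector precisely when \<open>c u\<^sub>n = 2 \<zeta>\<close>, and this is the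
  characteristic equation.
\<close>

lemma char_eq_imp_negative_eigenvalue:
  assumes r: "0 < r" "r < 1" and c: "c > 0" and n: "n \<ge> 1" and eq: "char_eq n c r"
  shows "is_negative_eigenvalue n c (eigenvalue_at (r\<^sup>2))"
proof -
  define x y where "x = 2 * r / (1 + r\<^sup>2)" and "y = (1 - r\<^sup>2) / (1 + r\<^sup>2)"
  define z where "z = of_real r * Complex x y"
  define w where "w = (1 - r\<^sup>2)\<^sup>2 / (r * (1 + r\<^sup>2))"
  define \<zeta> where "\<zeta> = \<i> * of_real w"
  define G where "G = green z n"
  define u where "u = (\<lambda>m. G m - cnj (G m))"
  have r2: "r\<^sup>2 < 1" using r by (simp add: abs_square_less_1)
  have pos: "1 + r\<^sup>2 > 0" by (simp add: add_pos_nonneg)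
  have w: "w > 0" using r r2 pos by (simp add: w_def)
  have xy: "x\<^sup>2 + y\<^sup>2 = 1"
  proof -
    have "x\<^sup>2 + y\<^sup>2 = ((2 * r)\<^sup>2 + (1 - r\<^sup>2)\<^sup>2) / (1 + r\<^sup>2)\<^sup>2"
      by (simp add: x_def y_def power_divide add_divide_distrib)
    also have "(2 * r)\<^sup>2 + (1 - r\<^sup>2)\<^sup>2 = (1 + r\<^sup>2)\<^sup>2" by algebra
    finally show ?thesis using pos by simp
  qed
  have "cmod (Complex x y) = 1" using xy by (simp add: cmod_def)
  then have norm_z: "cmod z = r" using r unfolding z_def norm_mult by simp
  have z0: "z \<noteq> 0" using norm_z r by auto
  have z1: "z\<^sup>2 \<noteq> 1"
  proof
    assume "z\<^sup>2 = 1"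
    then have "r\<^sup>2 = 1" using norm_z by (metis norm_power norm_one)
    then show False using r2 by simp
  qed
  have inv_z: "1 / z = of_real (1 / r) * Complex x (- y)"
  proof -
    have "z * (of_real (1 / r) * Complex x (- y)) = 1"
      using r xy by (simp add: z_def complex_eq_iff power2_eq_square)
    then show ?thesis using z0 by (simp add: field_simps)
  qed
  have \<zeta>: "2 - z - 1 / z = \<zeta>"
  proof -
    have "2 - r * (2 * r / P) - (2 * r / P) / r = 0" if "P = 1 + r\<^sup>2" "P > 0" for P
      using r that(2) by (simp add: field_simps) (simp add: that(1) power2_eq_square algebra_simps)
    moreover have "- r * (b / P) + (b / P) / r = b\<^sup>2 / (r * P)" if "b = 1 - r\<^sup>2" "P > 0" for b P
    proof -
      have "- r * (b / P) + (b / P) / r = b * (1 - r\<^sup>2) / (r * P)"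
        using r that(2) by (simp add: field_simps power2_eq_square)
      then show ?thesis by (simp add: that(1) power2_eq_square)
    qed
    ultimately have "2 - r * x - x / r = 0" "- r * y + y / r = w"
      using pos by (simp_all only: x_def y_def w_def)
    then show ?thesis unfolding inv_z by (simp add: z_def \<zeta>_def complex_eq_iff)
  qed
  have cnj_\<zeta>: "cnj \<zeta> = - \<zeta>" by (simp add: \<zeta>_def)
  have LG: "neg_laplacian G = (\<lambda>m. \<zeta> * G m + ell2_basis n m)"
    unfolding G_def using neg_laplacian_green[OF z0 z1 n] \<zeta> by simp
  have "neg_laplacian (\<lambda>m. cnj (G m)) = (\<lambda>m. cnj (neg_laplacian G m))"
    by (auto simp: neg_laplacian_def)
  then have LcG: "neg_laplacian (\<lambda>m. cnj (G m)) = (\<lambda>m. - \<zeta> * cnj (G m) + ell2_basis n m)"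
    by (simp add: LG cnj_\<zeta> ell2_basis_def if_distrib cong: if_cong)
  have Lu: "neg_laplacian u = (\<lambda>m. \<zeta> * G m + \<zeta> * cnj (G m))"
    using neg_laplacian_lincomb[of 1 G "-1" "\<lambda>m. cnj (G m)"] by (simp add: u_def LG LcG)
  have LLu: "bilaplacian u = (\<lambda>m. \<zeta>\<^sup>2 * u m + 2 * \<zeta> * ell2_basis n m)"
    unfolding bilaplacian_def Lu neg_laplacian_lincomb
    by (simp add: u_def LG LcG power2_eq_square algebra_simps)
  have "Im (z ^ (2 * j + 1)) = y * r * ((r\<^sup>2) ^ j * poly (chebyshev_U (2 * j)) x)" for j
  proof -
    have "Im (z ^ (2 * j + 1)) = r ^ (2 * j + 1) * Im (Complex x y ^ Suc (2 * j))"
      unfolding z_def power_mult_distrib of_real_power[symmetric] by simp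
    then show ?thesis unfolding Im_power_chebyshev[OF xy] by (simp add: power_mult)
  qed
  then have "Im (G n) = y * r * cheb_sum n (r\<^sup>2)"
    using r unfolding G_def green_diagonal[OF z0 z1] cheb_sum_def
    by (simp add: Im_sum sum_distrib_left x_def)
  then have "c * Im (G n) = y / r * (c * r\<^sup>2 * cheb_sum n (r\<^sup>2))"
    using r by (simp add: power2_eq_square)
  also have "\<dots> = y / r * (1 - r\<^sup>2)"
    using eq char_eq_iff[OF r c] by simp
  also have "\<dots> = w"
    by (simp add: y_def w_def power2_eq_square)
  finally have "of_real c * u n = 2 * \<zeta>"
    by (simp add: u_def \<zeta>_def complex_eq_iff algebra_simps)
  then have "perturbed n c u = (\<lambda>k. \<zeta>\<^sup>2 * u k)"
    by (auto simp: perturbed_apply LLu ell2_basis_def)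
  moreover have "\<zeta>\<^sup>2 = of_real (eigenvalue_at (r\<^sup>2))"
    using r by (simp add: \<zeta>_def w_def eigenvalue_at_def power_mult_distrib power_divide)
  moreover have "u \<in> ell2"
  proof -
    have G: "G \<in> ell2" unfolding G_def using norm_z r by (intro green_in_ell2) auto
    then have "(\<lambda>m. cnj (G m)) \<in> ell2" by (simp add: ell2_def)
    from ell2_lincomb[OF G this, of 1 "-1"] show ?thesis by (simp add: u_def)
  qed
  moreover have "u \<noteq> (\<lambda>k. 0)"
    using \<open>of_real c * u n = 2 * \<zeta>\<close> w by (auto simp: \<zeta>_def)
  moreover have "eigenvalue_at (r\<^sup>2) < 0"
    using r r2 pos by (simp add: eigenvalue_at_def)
  ultimately show ?thesis
    unfolding is_negative_eigenvalue_def is_eigenvalue_def by auto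
qed

section \<open>The characteristic equation\<close>

lemma eigenvalue_at_strict_mono:
  assumes "0 < p" "p < q" "q < 1"
  shows "eigenvalue_at p < eigenvalue_at q"
proof -
  have "(1 - q) ^ 4 < (1 - p) ^ 4"
    using assms by (intro power_strict_mono) auto
  moreover have "p * (1 + p)\<^sup>2 < q * (1 + q)\<^sup>2"
    using assms by (intro mult_strict_mono power_strict_mono) auto
  ultimately have "(1 - q) ^ 4 / (q * (1 + q)\<^sup>2) < (1 - p) ^ 4 / (p * (1 + p)\<^sup>2)"
    using assms by (intro frac_less) auto
  then show ?thesis by (simp add: eigenvalue_at_def)
qed

text \<open>
  The eigenvalue grows strictly with \<open>r\<close>, so uniqueness of the negative eigenvalue makes the
  solution of the characteristic equation unique.
\<close>

lemma char_eq_unique: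
  assumes "n \<ge> 1" "c > 0" "r \<in> {0<..<1}" "s \<in> {0<..<1}" "char_eq n c r" "char_eq n c s"
  shows "r = s"
proof -
  have "eigenvalue_at (r\<^sup>2) = eigenvalue_at (s\<^sup>2)"
    using assms by (intro negative_eigenvalue_unique char_eq_imp_negative_eigenvalue) auto
  moreover have "eigenvalue_at (a\<^sup>2) < eigenvalue_at (b\<^sup>2)" if "0 < a" "a < b" "b < 1" for a b
    using that by (intro eigenvalue_at_strict_mono power_strict_mono) (auto simp: abs_square_less_1)
  ultimately show ?thesis
    using assms(3,4) by (metis greaterThanLessThan_iff less_irrefl linorder_less_linear)
qed

lemma chebyshev_U_at_1: "poly (chebyshev_U k) 1 = real k + 1"
  by (induction k rule: chebyshev_U.induct) auto

lemma cheb_sum_at_1: "cheb_sum n 1 = (real n)\<^sup>2"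
  by (induction n) (auto simp: cheb_sum_def chebyshev_U_at_1 power2_eq_square algebra_simps)

lemma continuous_on_cheb_sum: "continuous_on {0..1} (cheb_sum n)"
  unfolding cheb_sum_def by (intro continuous_intros) (auto simp: add_nonneg_eq_0_iff)

text \<open>
  At \<open>q = 0\<close> the left side of \<open>c q S(q) = 1 - q\<close> is smaller than the right side. The point \<open>b = 1\<close>
  gives existence; small \<open>b\<close> will bound the solution for large \<open>c\<close>.
\<close>

lemma char_eq_root_below:
  assumes c: "c > 0" and b: "0 < b" "b \<le> 1" and pos: "c * b * cheb_sum n b > 1 - b"
  obtains r where "r \<in> {0<..<1}" "r\<^sup>2 < b" "char_eq n c r"
proof -
  let ?h = "\<lambda>q. c * q * cheb_sum n q - (1 - q)"
  have "continuous_on {0..b} ?h"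
    using b by (intro continuous_intros continuous_on_subset[OF continuous_on_cheb_sum]) auto
  then obtain q where q: "0 \<le> q" "q \<le> b" "?h q = 0"
    using IVT'[of ?h 0 0 b] pos b by auto
  have "q \<noteq> 0" "q \<noteq> b" using q pos by auto
  then have "0 < q" "q < b" using q by auto
  show ?thesis
  proof
    show "sqrt q \<in> {0<..<1}" "(sqrt q)\<^sup>2 < b" using \<open>0 < q\<close> \<open>q < b\<close> b by auto
    then show "char_eq n c (sqrt q)"
      using q c \<open>0 < q\<close> by (subst char_eq_iff) auto
  qed
qed

lemma char_eq_ex1:
  assumes "n \<ge> 1" "c > 0"
  shows "\<exists>!r. r \<in> {0<..<1} \<and> char_eq n c r"
proof -
  have "c * 1 * cheb_sum n 1 > 1 - 1" using assms by (simp add: cheb_sum_at_1)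
  then obtain r where "r \<in> {0<..<1}" "char_eq n c r"
    using char_eq_root_below[of c 1 n] assms by auto
  then show ?thesis using char_eq_unique[OF assms] by blast
qed

lemma neg_eigenvalue_eq:
  assumes "n \<ge> 1" "c > 0" "r \<in> {0<..<1}" "char_eq n c r"
  shows "is_negative_eigenvalue n c (eigenvalue_at (r\<^sup>2))"
    and "neg_eigenvalue n c = eigenvalue_at (r\<^sup>2)"
proof -
  show *: "is_negative_eigenvalue n c (eigenvalue_at (r\<^sup>2))"
    using assms by (intro char_eq_imp_negative_eigenvalue) auto
  show "neg_eigenvalue n c = eigenvalue_at (r\<^sup>2)"
    unfolding neg_eigenvalue_def using * negative_eigenvalue_unique[OF assms(1)] by blast
qed

lemma neg_eigenvalue_1:
  assumes "c > 0"
  shows "neg_eigenvalue 1 c = - (c ^ 4 / ((c + 1) * (c + 2)\<^sup>2))"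
proof -
  define q where "q = 1 / (c + 1)"
  have q: "0 < q" "q < 1" using assms by (auto simp: q_def)
  have "c * q = 1 - q" using assms by (simp add: q_def field_simps)
  then have "char_eq 1 c (sqrt q)"
    using q assms by (subst char_eq_iff) (auto simp: cheb_sum_def)
  then have "neg_eigenvalue 1 c = eigenvalue_at q"
    using neg_eigenvalue_eq(2)[of 1 c "sqrt q"] q assms by simp
  moreover have "1 - q = c / (c + 1)" "1 + q = (c + 2) / (c + 1)"
    using assms by (auto simp: q_def field_simps)
  ultimately have "neg_eigenvalue 1 c = - ((c / (c + 1)) ^ 4 / (1 / (c + 1) * ((c + 2) / (c + 1))\<^sup>2))"
    by (simp only: eigenvalue_at_def) (simp only: q_def)
  moreover have "(c / a) ^ 4 / (1 / a * (b / a)\<^sup>2) = c ^ 4 / (a * b\<^sup>2)" if "a > 0" "b > 0" for a b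
  proof -
    have "a ^ 4 = a\<^sup>2 * (a * a)" by (simp add: eval_nat_numeral)
    then show ?thesis using that by (simp add: power_divide)
  qed
  ultimately show ?thesis using assms by simp
qed


section \<open>Asymptotic expansions of the Chebyshev sum\<close>

text \<open>
  The argument of the Chebyshev polynomials is of order \<open>sqrt q\<close> and \<open>U\<^sub>2 (x) = 4 x\<^sup>2 - 1\<close>, so the term
  with \<open>j = 1\<close> is \<open>- q + O(q\<^sup>2)\<close>; the later terms carry a factor \<open>q\<^sup>2\<close>.
\<close>

lemma cheb_sum_expansion_0:
  assumes "n \<ge> 2"
  shows "(\<lambda>q. cheb_sum n q - (1 - q)) \<in> O[at_right 0](\<lambda>q. q\<^sup>2)"
proof -
  obtain m where m: "n = Suc (Suc m)" using assms by (metis add_2_eq_Suc le_Suc_ex)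
  let ?x = "\<lambda>q::real. 2 * sqrt q / (1 + q)"
  let ?t = "\<lambda>j q. q ^ Suc (Suc j) * poly (chebyshev_U (2 * Suc (Suc j))) (?x q)"
  have x: "(?x \<longlongrightarrow> 0) (at_right 0)" by real_asymp
  have tail: "?t j \<in> O[at_right 0](\<lambda>q. q\<^sup>2)" for j
  proof -
    have "((\<lambda>q. q ^ j * poly (chebyshev_U (2 * Suc (Suc j))) (?x q))
        \<longlongrightarrow> 0 ^ j * poly (chebyshev_U (2 * Suc (Suc j))) 0) (at_right 0)"
      by (intro tendsto_mult tendsto_power tendsto_ident_at tendsto_poly x)
    then have "(\<lambda>q. q ^ j * poly (chebyshev_U (2 * Suc (Suc j))) (?x q)) \<in> O[at_right 0](\<lambda>_. 1)"
      by (intro bigoI_tendsto[of _ "\<lambda>_. 1"]) auto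
    from landau_o.big_mult[OF landau_o.big_refl[of "\<lambda>q::real. q\<^sup>2"] this]
    show ?thesis by (simp add: power2_eq_square mult.assoc)
  qed
  have U: "poly (chebyshev_U (2 * 0)) x = 1" "poly (chebyshev_U (2 * Suc 0)) x = 4 * x\<^sup>2 - 1" for x
    by (simp_all add: numeral_2_eq_2)
  have alg: "1 + (q * (4 * x\<^sup>2 - 1) + T) - (1 - q) = 4 * q * x\<^sup>2 + T" for q x T :: real
    by (simp add: algebra_simps)
  have "cheb_sum n q - (1 - q) = 4 * q * (?x q)\<^sup>2 + (\<Sum>j<m. ?t j q)" for q
    unfolding cheb_sum_def m sum.lessThan_Suc_shift
    by (simp only: U power_0 mult_1_left power_Suc0_right alg)
  moreover have "(\<lambda>q. 4 * q * (?x q)\<^sup>2) \<in> O[at_right 0](\<lambda>q. q\<^sup>2)"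
    by real_asymp
  ultimately show ?thesis
    by (simp only: sum_in_bigo big_sum_in_bigo tail)
qed

text \<open>
  At \<open>q = 1\<close> the argument \<open>2 sqrt q / (1 + q)\<close> attains its maximum \<open>1\<close>, so its deviation
  is of second order and only the factors \<open>q ^ j\<close> contribute to the linear term.
\<close>

lemma cheb_term_expansion_1:
  "(\<lambda>\<epsilon>. (1 - \<epsilon>) ^ j * poly (chebyshev_U (2 * j)) (2 * sqrt (1 - \<epsilon>) / (1 + (1 - \<epsilon>)))
      - (2 * real j + 1) * (1 - real j * \<epsilon>)) \<in> O[at_right 0](\<lambda>\<epsilon>. \<epsilon>\<^sup>2)"
proof -
  let ?x = "\<lambda>\<epsilon>::real. 2 * sqrt (1 - \<epsilon>) / (1 + (1 - \<epsilon>))"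
  let ?p = "chebyshev_U (2 * j)"
  \<comment> \<open>Divide \<open>U - U(1)\<close> by \<open>x - 1\<close>: its size is then controlled by \<open>x - 1 = O(\<epsilon>\<^sup>2)\<close>.\<close>
  have "[:- 1, 1:] dvd ?p - [:poly ?p 1:]"
    by (simp add: poly_eq_0_iff_dvd[symmetric])
  then obtain k where "?p - [:poly ?p 1:] = [:- 1, 1:] * k" by (rule dvdE)
  then have k: "poly ?p x - poly ?p 1 = (x - 1) * poly k x" for x
  proof -
    have "poly ?p x - poly ?p 1 = poly (?p - [:poly ?p 1:]) x" by simp
    also have "\<dots> = (x - 1) * poly k x"
      unfolding \<open>?p - [:poly ?p 1:] = [:- 1, 1:] * k\<close> by (simp add: algebra_simps)
    finally show ?thesis .
  qed
  have "(?x \<longlongrightarrow> 1) (at_right 0)" by real_asymp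
  then have "((\<lambda>\<epsilon>. poly k (?x \<epsilon>)) \<longlongrightarrow> poly k 1) (at_right 0)" by (rule tendsto_poly)
  then have "(\<lambda>\<epsilon>. poly k (?x \<epsilon>)) \<in> O[at_right 0](\<lambda>_. 1)"
    by (intro bigoI_tendsto[of _ "\<lambda>_. 1"]) auto
  moreover have "(\<lambda>\<epsilon>. ?x \<epsilon> - 1) \<in> O[at_right 0](\<lambda>\<epsilon>. \<epsilon>\<^sup>2)" by real_asymp
  ultimately have "(\<lambda>\<epsilon>. (?x \<epsilon> - 1) * poly k (?x \<epsilon>)) \<in> O[at_right 0](\<lambda>\<epsilon>. \<epsilon>\<^sup>2 * 1)"
    by (intro landau_o.big_mult)
  then have poly: "(\<lambda>\<epsilon>. poly ?p (?x \<epsilon>) - (2 * real j + 1)) \<in> O[at_right 0](\<lambda>\<epsilon>. \<epsilon>\<^sup>2)"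
    by (simp add: k[symmetric] chebyshev_U_at_1)
  have "((\<lambda>\<epsilon>::real. (1 - \<epsilon>) ^ j) \<longlongrightarrow> (1 - 0) ^ j) (at_right 0)"
    by (intro tendsto_intros)
  then have bounded: "(\<lambda>\<epsilon>::real. (1 - \<epsilon>) ^ j) \<in> O[at_right 0](\<lambda>_. 1)"
    by (intro bigoI_tendsto[of _ "\<lambda>_. 1"]) auto
  have power: "(\<lambda>\<epsilon>::real. (1 - \<epsilon>) ^ i - (1 - real i * \<epsilon>)) \<in> O[at_right 0](\<lambda>\<epsilon>. \<epsilon>\<^sup>2)" for i
  proof (induction i)
    case (Suc i)
    have "(\<lambda>\<epsilon>::real. 1 - \<epsilon>) \<in> O[at_right 0](\<lambda>_. 1)" by real_asymp
    from landau_o.big_mult[OF this Suc]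
    have "(\<lambda>\<epsilon>::real. (1 - \<epsilon>) * ((1 - \<epsilon>) ^ i - (1 - real i * \<epsilon>))) \<in> O[at_right 0](\<lambda>\<epsilon>. \<epsilon>\<^sup>2)"
      by simp
    moreover have "(\<lambda>\<epsilon>::real. real i * \<epsilon>\<^sup>2) \<in> O[at_right 0](\<lambda>\<epsilon>. \<epsilon>\<^sup>2)" by simp
    ultimately have "(\<lambda>\<epsilon>::real. (1 - \<epsilon>) * ((1 - \<epsilon>) ^ i - (1 - real i * \<epsilon>)) + real i * \<epsilon>\<^sup>2)
        \<in> O[at_right 0](\<lambda>\<epsilon>. \<epsilon>\<^sup>2)"
      by (rule sum_in_bigo)
    then show ?case by (simp add: algebra_simps power2_eq_square)
  qed simp
  have "(\<lambda>\<epsilon>. (1 - \<epsilon>) ^ j * (poly ?p (?x \<epsilon>) - (2 * real j + 1))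
      + (2 * real j + 1) * ((1 - \<epsilon>) ^ j - (1 - real j * \<epsilon>))) \<in> O[at_right 0](\<lambda>\<epsilon>. \<epsilon>\<^sup>2)"
    using landau_o.big_mult[OF bounded poly] power[of j]
    by (intro sum_in_bigo) simp_all
  moreover have "P * (v - a) + a * (P - l) = P * v - a * l" for P v a l :: real
    by (simp add: algebra_simps)
  ultimately show ?thesis by (simp only:)
qed

lemma cheb_sum_expansion_1:
  "(\<lambda>\<epsilon>. cheb_sum n (1 - \<epsilon>)
      - ((real n)\<^sup>2 - real n * (real n - 1) * (4 * real n + 1) / 6 * \<epsilon>))
    \<in> O[at_right 0](\<lambda>\<epsilon>. \<epsilon>\<^sup>2)"
proof (induction n)
  case (Suc n)
  have coeff: "real (Suc n) * (real (Suc n) - 1) * (4 * real (Suc n) + 1) / 6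
      = real n * (real n - 1) * (4 * real n + 1) / 6 + (2 * real n + 1) * real n"
    by (simp add: field_simps)
  show ?case
    using sum_in_bigo(1)[OF Suc cheb_term_expansion_1[of n]] unfolding coeff
    by (simp add: cheb_sum_def algebra_simps power2_eq_square)
qed (simp add: cheb_sum_def)

text \<open>Normalising the value at \<open>0\<close> to \<open>1\<close> makes the first-order coefficients add under products.\<close>

definition has_slope :: "real \<Rightarrow> (real \<Rightarrow> real) \<Rightarrow> bool" where
  "has_slope a f \<longleftrightarrow> (\<lambda>\<epsilon>. f \<epsilon> - (1 - a * \<epsilon>)) \<in> O[at_right 0](\<lambda>\<epsilon>. \<epsilon>\<^sup>2)"

lemma has_slope_imp_deviation:
  assumes "has_slope a f"
  shows "(\<lambda>\<epsilon>. f \<epsilon> - 1) \<in> O[at_right 0](\<lambda>\<epsilon>. \<epsilon>)"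
proof -
  have "(\<lambda>\<epsilon>::real. \<epsilon>\<^sup>2) \<in> O[at_right 0](\<lambda>\<epsilon>. \<epsilon>)" by real_asymp
  then have "(\<lambda>\<epsilon>. f \<epsilon> - (1 - a * \<epsilon>)) \<in> O[at_right 0](\<lambda>\<epsilon>. \<epsilon>)"
    using assms unfolding has_slope_def by (rule landau_o.big_trans[rotated])
  moreover have "(\<lambda>\<epsilon>. a * \<epsilon>) \<in> O[at_right 0](\<lambda>\<epsilon>. \<epsilon>)" by simp
  ultimately have "(\<lambda>\<epsilon>. (f \<epsilon> - (1 - a * \<epsilon>)) - a * \<epsilon>) \<in> O[at_right 0](\<lambda>\<epsilon>. \<epsilon>)"
    by (rule sum_in_bigo)
  then show ?thesis by simp
qed

lemma has_slope_imp_tendsto: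
  assumes "has_slope a f"
  shows "(f \<longlongrightarrow> 1) (at_right 0)"
proof -
  have "(\<lambda>\<epsilon>::real. \<epsilon>) \<in> o[at_right 0](\<lambda>_. 1)" by real_asymp
  then have "(\<lambda>\<epsilon>. f \<epsilon> - 1) \<in> o[at_right 0](\<lambda>_. 1)"
    using has_slope_imp_deviation[OF assms] by (rule landau_o.big_small_trans[rotated])
  then have "((\<lambda>\<epsilon>. f \<epsilon> - 1) \<longlongrightarrow> 0) (at_right 0)"
    by (auto dest: smalloD_tendsto)
  then show ?thesis by (simp add: LIM_zero_iff)
qed

lemma has_slope_mult:
  assumes "has_slope a f" "has_slope b g"
  shows "has_slope (a + b) (\<lambda>\<epsilon>. f \<epsilon> * g \<epsilon>)"
proof -
  have g: "g \<in> O[at_right 0](\<lambda>_. 1)"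
    using has_slope_imp_tendsto[OF assms(2)] by (intro bigoI_tendsto[of _ "\<lambda>_. 1"]) auto
  have l: "(\<lambda>\<epsilon>. 1 - a * \<epsilon>) \<in> O[at_right 0](\<lambda>_. 1)"
    by (rule bigoI_tendsto[of _ _ 1]) (auto intro!: tendsto_eq_intros)
  have "(\<lambda>\<epsilon>. (f \<epsilon> - (1 - a * \<epsilon>)) * g \<epsilon> + (1 - a * \<epsilon>) * (g \<epsilon> - (1 - b * \<epsilon>)) + a * b * \<epsilon>\<^sup>2)
      \<in> O[at_right 0](\<lambda>\<epsilon>. \<epsilon>\<^sup>2)"
    using landau_o.big_mult[OF assms(1)[unfolded has_slope_def] g]
      landau_o.big_mult[OF l assms(2)[unfolded has_slope_def]]
    by (intro sum_in_bigo) simp_all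
  then show ?thesis unfolding has_slope_def by (simp add: algebra_simps power2_eq_square)
qed

section \<open>The weak and the strong coupling limit\<close>

text \<open>The square of the solution \<open>r\<close>, since eigenvalue and expansions are functions of \<open>r\<^sup>2\<close>.\<close>

definition char_root :: "nat \<Rightarrow> real \<Rightarrow> real" where
  "char_root n c = (THE r. r \<in> {0<..<1} \<and> char_eq n c r)\<^sup>2"

lemma char_root_unique:
  assumes "n \<ge> 1" "c > 0" "r \<in> {0<..<1}" "char_eq n c r"
  shows "char_root n c = r\<^sup>2"
  unfolding char_root_def
  using the1_equality[OF char_eq_ex1[OF assms(1,2)] conjI[OF assms(3,4)]] by (rule arg_cong)

lemma char_root:
  assumes "n \<ge> 1" "c > 0"
  shows "0 < char_root n c" "char_root n c < 1"
    and "c * char_root n c * cheb_sum n (char_root n c) = 1 - char_root n c"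
    and "neg_eigenvalue n c = eigenvalue_at (char_root n c)"
proof -
  obtain r where r: "r \<in> {0<..<1}" "char_eq n c r" using char_eq_ex1[OF assms] by blast
  have q: "char_root n c = r\<^sup>2" using assms r by (rule char_root_unique)
  show "0 < char_root n c" "char_root n c < 1" using r by (auto simp: q abs_square_less_1)
  show "c * char_root n c * cheb_sum n (char_root n c) = 1 - char_root n c"
    using r assms char_eq_iff[of r c n] by (simp add: q)
  show "neg_eigenvalue n c = eigenvalue_at (char_root n c)"
    unfolding q using assms r by (rule neg_eigenvalue_eq)
qed

lemma char_root_weak_coupling:
  assumes "n \<ge> 1"
  shows "(\<lambda>c. 1 - char_root n c) \<in> O[at_right 0](\<lambda>c. c)"
    and "filterlim (\<lambda>c. 1 - char_root n c) (at_right 0) (at_right 0)"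
proof -
  obtain M where M: "M \<ge> 0" "\<And>q. q \<in> {0..1} \<Longrightarrow> norm (cheb_sum n q) \<le> M"
    using continuous_on_compact_bound[OF compact_Icc continuous_on_cheb_sum] by metis
  have le: "1 - char_root n c \<le> M * c" if "c > 0" for c
  proof -
    note q = char_root[OF assms that]
    have "1 - char_root n c = c * char_root n c * cheb_sum n (char_root n c)" using q by simp
    also have "\<dots> \<le> c * char_root n c * M"
      using q that M(2)[of "char_root n c"] by (intro mult_left_mono) auto
    also have "\<dots> \<le> c * 1 * M"
      using q that M(1) by (intro mult_right_mono mult_left_mono) auto
    finally show ?thesis by (simp add: mult.commute)
  qed
  have ev: "eventually (\<lambda>c::real. c > 0) (at_right 0)" by (simp add: eventually_at_right_less)
  show big: "(\<lambda>c. 1 - char_root n c) \<in> O[at_right 0](\<lambda>c. c)"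
    using ev by (intro bigoI[of _ M], eventually_elim) (use le char_root(2)[OF assms] in fastforce)
  have "(\<lambda>c::real. c) \<in> o[at_right 0](\<lambda>_. 1)" by real_asymp
  with big have "(\<lambda>c. 1 - char_root n c) \<in> o[at_right 0](\<lambda>_. 1)"
    by (rule landau_o.big_small_trans)
  then have "((\<lambda>c. 1 - char_root n c) \<longlongrightarrow> 0) (at_right 0)"
    by (auto dest: smalloD_tendsto)
  moreover have "eventually (\<lambda>c. 1 - char_root n c > 0) (at_right 0)"
    using ev by eventually_elim (use char_root(2)[OF assms] in simp)
  ultimately show "filterlim (\<lambda>c. 1 - char_root n c) (at_right 0) (at_right 0)"
    unfolding filterlim_at by (auto elim: eventually_mono)
qed

text \<open>
  The characteristic equation expresses \<open>c\<close> through \<open>\<epsilon> = 1 - r\<^sup>2\<close>, so the remainder is an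
  explicit function of \<open>\<epsilon>\<close>. In it the terms of order at most one cancel: divided by its leading
  term, the eigenvalue is a factor of slope \<open>2\<close> times the fourth power of the normalised Chebyshev
  sum \<open>t\<close>, of slope \<open>b\<close>; and \<open>2 + 4 b\<close> is \<open>1 / n\<^sup>2\<close> times the stated coefficient \<open>A\<close>, which matches
  because \<open>c = \<epsilon> / n\<^sup>2 + O(\<epsilon>\<^sup>2)\<close>.
\<close>

lemma neg_eigenvalue_weak_coupling:
  assumes n: "n \<ge> 1"
  shows "\<exists>g \<in> O[at_right 0](\<lambda>c::real. c\<^sup>2). \<forall>c>0.
    neg_eigenvalue n c = - (real n ^ 8 * c ^ 4 / 4) *
      (1 - 2 * real n * (4 * (real n)\<^sup>2 - 1) / 3 * c + g c)"
proof -
  define N where "N = real n"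
  have N: "N > 0" using n by (simp add: N_def)
  define b where "b = (N - 1) * (4 * N + 1) / (6 * N)"
  define A where "A = 2 * N * (4 * N\<^sup>2 - 1) / 3"
  define t where "t = (\<lambda>\<epsilon>. cheb_sum n (1 - \<epsilon>) / N\<^sup>2)"
  have A: "A / N\<^sup>2 = 2 + 4 * b"
    using N by (simp add: A_def b_def field_simps power2_eq_square)
  have "has_slope b t"
  proof -
    have "(\<lambda>\<epsilon>. 1 / N\<^sup>2 * (cheb_sum n (1 - \<epsilon>) - (N\<^sup>2 - N * (N - 1) * (4 * N + 1) / 6 * \<epsilon>)))
        \<in> O[at_right 0](\<lambda>\<epsilon>. \<epsilon>\<^sup>2)"
      using cheb_sum_expansion_1[of n] N by (simp add: N_def)
    moreover have "1 / N\<^sup>2 * (s - (N\<^sup>2 - N * (N - 1) * (4 * N + 1) / 6 * \<epsilon>))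
        = s / N\<^sup>2 - (1 - b * \<epsilon>)" for s \<epsilon>
      using N by (simp add: b_def field_simps power2_eq_square)
    ultimately show ?thesis by (simp only: has_slope_def t_def)
  qed
  then have t4: "has_slope (b + (b + (b + b))) (\<lambda>\<epsilon>. t \<epsilon> * (t \<epsilon> * (t \<epsilon> * t \<epsilon>)))"
    by (intro has_slope_mult)
  have "has_slope 2 (\<lambda>\<epsilon>. 4 * (1 - \<epsilon>) ^ 3 / (2 - \<epsilon>)\<^sup>2)"
    unfolding has_slope_def by real_asymp
  note has_slope_mult[OF this t4]
  moreover have slope: "2 + (b + (b + (b + b))) = A / N\<^sup>2" unfolding A by simp
  moreover have fourth: "v * (v * (v * v)) = v ^ 4" for v :: real
    by (simp add: power4_eq_xxxx mult.assoc)
  ultimately have main: "has_slope (A / N\<^sup>2) (\<lambda>\<epsilon>. 4 * (1 - \<epsilon>) ^ 3 / (2 - \<epsilon>)\<^sup>2 * t \<epsilon> ^ 4)"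
    by (simp only: slope fourth)
  have "has_slope 1 (\<lambda>\<epsilon>. 1 - \<epsilon>)" by (simp add: has_slope_def)
  from has_slope_mult[OF this \<open>has_slope b t\<close>]
  have f: "has_slope (1 + b) (\<lambda>\<epsilon>. (1 - \<epsilon>) * t \<epsilon>)" .
  let ?f = "\<lambda>\<epsilon>. (1 - \<epsilon>) * t \<epsilon>"
  have lin: "(\<lambda>\<epsilon>. \<epsilon> / ?f \<epsilon> - \<epsilon>) \<in> O[at_right 0](\<lambda>\<epsilon>. \<epsilon>\<^sup>2)"
  proof -
    have lim: "(?f \<longlongrightarrow> 1) (at_right 0)" using f by (rule has_slope_imp_tendsto)
    then have "((\<lambda>\<epsilon>. 1 / ?f \<epsilon>) \<longlongrightarrow> 1 / 1) (at_right 0)" by (intro tendsto_divide) auto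
    then have inv: "(\<lambda>\<epsilon>. 1 / ?f \<epsilon>) \<in> O[at_right 0](\<lambda>_. 1)"
      by (intro bigoI_tendsto[of _ "\<lambda>_. 1"]) auto
    have id: "(\<lambda>\<epsilon>::real. - \<epsilon>) \<in> O[at_right 0](\<lambda>\<epsilon>. \<epsilon>)" by simp
    have "(\<lambda>\<epsilon>. - \<epsilon> * (?f \<epsilon> - 1) * (1 / ?f \<epsilon>)) \<in> O[at_right 0](\<lambda>\<epsilon>. \<epsilon> * \<epsilon> * 1)"
      by (intro landau_o.big_mult id has_slope_imp_deviation[OF f] inv)
    then have "(\<lambda>\<epsilon>. - \<epsilon> * (?f \<epsilon> - 1) * (1 / ?f \<epsilon>)) \<in> O[at_right 0](\<lambda>\<epsilon>. \<epsilon>\<^sup>2)"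
      by (simp add: power2_eq_square)
    moreover have "eventually (\<lambda>\<epsilon>. ?f \<epsilon> > 0) (at_right 0)"
      using lim by (rule order_tendstoD) simp
    then have "eventually (\<lambda>\<epsilon>. - \<epsilon> * (?f \<epsilon> - 1) * (1 / ?f \<epsilon>) = \<epsilon> / ?f \<epsilon> - \<epsilon>) (at_right 0)"
    proof (rule eventually_mono)
      show "- \<epsilon> * (v - 1) * (1 / v) = \<epsilon> / v - \<epsilon>" if "v > 0" for v \<epsilon> :: real
        using that by (simp add: field_simps)
    qed
    ultimately show ?thesis by (rule landau_o.big.in_cong[THEN iffD1, rotated])
  qed
  define G where "G = (\<lambda>\<epsilon>. 4 * (1 - \<epsilon>) ^ 3 / (2 - \<epsilon>)\<^sup>2 * t \<epsilon> ^ 4 - 1 + A / N\<^sup>2 * (\<epsilon> / ?f \<epsilon>))"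
  have const: "(\<lambda>_. A / N\<^sup>2) \<in> O[at_right 0](\<lambda>_. 1 :: real)" by simp
  have cancel: "m - (1 - k * e) + k * (d - e) = m - 1 + k * d" for m k d e :: real
    by (simp add: algebra_simps)
  have G: "G \<in> O[at_right 0](\<lambda>\<epsilon>. \<epsilon>\<^sup>2)"
    using sum_in_bigo(1)[OF main[unfolded has_slope_def]
        landau_o.big_mult[OF const lin, unfolded mult_1_left]]
    unfolding G_def cancel .
  let ?\<epsilon> = "\<lambda>c. 1 - char_root n c"
  have "(\<lambda>c. G (?\<epsilon> c)) \<in> O[at_right 0](\<lambda>c. (?\<epsilon> c)\<^sup>2)"
    using G char_root_weak_coupling(2)[OF n] by (rule landau_o.big.compose)
  also have "(\<lambda>c. (?\<epsilon> c)\<^sup>2) \<in> O[at_right 0](\<lambda>c. c\<^sup>2)"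
    using char_root_weak_coupling(1)[OF n] by (rule landau_o.big_power)
  finally have "(\<lambda>c. G (?\<epsilon> c)) \<in> O[at_right 0](\<lambda>c. c\<^sup>2)" .
  moreover have "neg_eigenvalue n c = - (N ^ 8 * c ^ 4 / 4) * (1 - A * c + G (?\<epsilon> c))"
    if c: "c > 0" for c
  proof -
    define q where "q = char_root n c"
    define s where "s = cheb_sum n q"
    have q: "0 < q" "q < 1" "c * q * s = 1 - q" "neg_eigenvalue n c = eigenvalue_at q"
      using char_root[OF n c] by (auto simp: q_def s_def)
    have s: "s \<noteq> 0" using q(2,3) by auto
    have t: "t (1 - q) = s / N\<^sup>2" by (simp add: t_def s_def)
    have "A / N\<^sup>2 * ((1 - q) / (q * (s / N\<^sup>2))) = A * c"
      using N q(1) s unfolding q(3)[symmetric] by (simp add: field_simps)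
    then have "1 - A * c + G (1 - q) = 4 * q ^ 3 / (1 + q)\<^sup>2 * (s / N\<^sup>2) ^ 4"
      unfolding G_def t by simp
    moreover have "- (N ^ 8 * c ^ 4 / 4) * (4 * q ^ 3 / (1 + q)\<^sup>2 * (s / N\<^sup>2) ^ 4)
        = - ((c * q * s) ^ 4 / (q * (1 + q)\<^sup>2))"
    proof -
      have "q ^ 4 = q * q ^ 3" by (simp add: eval_nat_numeral)
      then show ?thesis using N q(1) by (simp add: power_mult_distrib power_divide)
    qed
    ultimately have "- (N ^ 8 * c ^ 4 / 4) * (1 - A * c + G (1 - q))
        = - ((1 - q) ^ 4 / (q * (1 + q)\<^sup>2))"
      by (simp only: q(3))
    then show ?thesis by (simp only: q eigenvalue_at_def q_def)
  qed
  ultimately show ?thesis unfolding A_def N_def by (intro bexI[of _ "\<lambda>c. G (?\<epsilon> c)"]) auto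
qed

text \<open>
  The intermediate value theorem locates a solution of the characteristic equation with
  \<open>r\<^sup>2 < 2 / c\<close>, and uniqueness identifies it with \<open>char_root n c\<close>. The constant \<open>2\<close> serves because
  at \<open>q = 2 / c\<close> the left side of \<open>c q S(q) = 1 - q\<close> is close to \<open>2\<close>, whereas the right side is
  less than \<open>1\<close>.
\<close>

lemma char_root_strong_coupling:
  assumes "n \<ge> 1"
  shows "eventually (\<lambda>c. char_root n c < 2 / c) at_top"
proof -
  have "(cheb_sum n \<longlongrightarrow> cheb_sum n 0) (at 0 within {0..1})"
    using continuous_on_cheb_sum[of n] by (auto simp: continuous_on_def)
  moreover have "cheb_sum n 0 = 1"
  proof -
    obtain m where "n = Suc m" using assms by (cases n) auto
    then show ?thesis by (simp only: cheb_sum_def sum.lessThan_Suc_shift) simp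
  qed
  ultimately have "(cheb_sum n \<longlongrightarrow> 1) (at_right 0)"
    by (simp add: at_within_Icc_at_right)
  moreover have "filterlim (\<lambda>c::real. 2 / c) (at_right 0) at_top" by real_asymp
  ultimately have "((\<lambda>c. cheb_sum n (2 / c)) \<longlongrightarrow> 1) at_top" by (rule filterlim_compose)
  then have "eventually (\<lambda>c. cheb_sum n (2 / c) > 1 / 2) at_top" by (rule order_tendstoD) simp
  then show ?thesis using eventually_ge_at_top[of 2]
  proof eventually_elim
    case (elim c)
    have "1 - 2 / c < 1" using elim by simp
    also have "1 < 2 * cheb_sum n (2 / c)" using elim by simp
    also have "\<dots> = c * (2 / c) * cheb_sum n (2 / c)" using elim by simp
    finally have "1 - 2 / c < c * (2 / c) * cheb_sum n (2 / c)" .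
    then obtain r where "r \<in> {0<..<1}" "r\<^sup>2 < 2 / c" "char_eq n c r"
      using char_eq_root_below[of c "2 / c" n] elim by auto
    then show ?case using char_root_unique[OF assms, of c r] elim by simp
  qed
qed

text \<open>
  Substituting \<open>1 / c = q S(q) / (1 - q)\<close> turns the remainder into an explicit function of \<open>q\<close>. It is
  affine in \<open>S\<close>, so the error \<open>E\<close> in \<open>S(q) = 1 - q + E(q)\<close> only enters multiplied by a bounded function.
\<close>

lemma neg_eigenvalue_strong_coupling:
  assumes n: "n \<ge> 2"
  shows "\<exists>g \<in> O[at_top](\<lambda>c::real. 1 / c\<^sup>2). \<forall>c>0.
    neg_eigenvalue n c = - c * (1 - 6 / c + g c)"
proof -
  have n1: "n \<ge> 1" using n by simp
  define E where "E = (\<lambda>q. cheb_sum n q - (1 - q))"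
  define G where
    "G = (\<lambda>q. (1 - q) ^ 3 * cheb_sum n q / (1 + q)\<^sup>2 - 1 + 6 * (q * cheb_sum n q / (1 - q)))"
  have "(\<lambda>q::real. (1 - q) ^ 3 / (1 + q)\<^sup>2 + 6 * q / (1 - q)) \<in> O[at_right 0](\<lambda>_. 1)"
    by real_asymp
  from landau_o.big_mult[OF cheb_sum_expansion_0[OF n] this]
  have "(\<lambda>q. E q * ((1 - q) ^ 3 / (1 + q)\<^sup>2 + 6 * q / (1 - q))) \<in> O[at_right 0](\<lambda>q. q\<^sup>2)"
    unfolding E_def mult_1_right .
  moreover have "(\<lambda>q::real. (1 - q) ^ 3 * (1 - q) / (1 + q)\<^sup>2 - 1 + 6 * (q * (1 - q) / (1 - q)))
      \<in> O[at_right 0](\<lambda>q. q\<^sup>2)"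
    by real_asymp
  ultimately have "(\<lambda>q. E q * ((1 - q) ^ 3 / (1 + q)\<^sup>2 + 6 * q / (1 - q))
      + ((1 - q) ^ 3 * (1 - q) / (1 + q)\<^sup>2 - 1 + 6 * (q * (1 - q) / (1 - q))))
      \<in> O[at_right 0](\<lambda>q. q\<^sup>2)"
    by (rule sum_in_bigo)
  moreover have "G = (\<lambda>q. E q * ((1 - q) ^ 3 / (1 + q)\<^sup>2 + 6 * q / (1 - q))
      + ((1 - q) ^ 3 * (1 - q) / (1 + q)\<^sup>2 - 1 + 6 * (q * (1 - q) / (1 - q))))"
  proof (rule ext)
    fix q
    have split: "a * (e + b) / P - 1 + 6 * (q * (e + b) / d)
        = e * (a / P + 6 * q / d) + (a * b / P - 1 + 6 * (q * b / d))" for a b d e P :: real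
      by (simp add: distrib_left distrib_right add_divide_distrib mult.commute mult.left_commute)
    have "cheb_sum n q = E q + (1 - q)" by (simp add: E_def)
    then show "G q = E q * ((1 - q) ^ 3 / (1 + q)\<^sup>2 + 6 * q / (1 - q))
      + ((1 - q) ^ 3 * (1 - q) / (1 + q)\<^sup>2 - 1 + 6 * (q * (1 - q) / (1 - q)))"
      unfolding G_def by (simp only: split)
  qed
  ultimately have G: "G \<in> O[at_right 0](\<lambda>q. q\<^sup>2)" by (simp only:)
  have pos: "eventually (\<lambda>c. char_root n c > 0) at_top"
    using eventually_gt_at_top[of 0] by eventually_elim (rule char_root(1)[OF n1])
  have big: "(\<lambda>c. char_root n c) \<in> O[at_top](\<lambda>c. 1 / c)"
    using pos char_root_strong_coupling[OF n1] eventually_gt_at_top[of 0]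
    by (intro bigoI[of _ 2], eventually_elim) auto
  moreover have "(\<lambda>c::real. 1 / c) \<in> o[at_top](\<lambda>_. 1)" by real_asymp
  ultimately have "(\<lambda>c. char_root n c) \<in> o[at_top](\<lambda>_. 1)" by (rule landau_o.big_small_trans)
  then have "((\<lambda>c. char_root n c) \<longlongrightarrow> 0) at_top" by (auto dest: smalloD_tendsto)
  with pos have lim: "filterlim (\<lambda>c. char_root n c) (at_right 0) at_top"
    unfolding filterlim_at by (auto elim: eventually_mono)
  have "(\<lambda>c. G (char_root n c)) \<in> O[at_top](\<lambda>c. (char_root n c)\<^sup>2)"
    using G lim by (rule landau_o.big.compose)
  also have "(\<lambda>c. (char_root n c)\<^sup>2) \<in> O[at_top](\<lambda>c. (1 / c)\<^sup>2)"
    using big by (rule landau_o.big_power)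
  finally have "(\<lambda>c. G (char_root n c)) \<in> O[at_top](\<lambda>c. 1 / c\<^sup>2)"
    by (simp add: power_divide)
  moreover have "neg_eigenvalue n c = - c * (1 - 6 / c + G (char_root n c))" if c: "c > 0" for c
  proof -
    define q where "q = char_root n c"
    define s where "s = cheb_sum n q"
    have q: "0 < q" "q < 1" "c * q * s = 1 - q" "neg_eigenvalue n c = eigenvalue_at q"
      using char_root[OF n1 c] by (auto simp: q_def s_def)
    have "s \<noteq> 0" using q(2,3) by auto
    have "q * s / (1 - q) = 1 / c"
      unfolding q(3)[symmetric] using c q(1) \<open>s \<noteq> 0\<close> by simp
    then have "1 - 6 / c + G q = (1 - q) ^ 3 * s / (1 + q)\<^sup>2"
      unfolding G_def s_def[symmetric] by simp
    then have "- c * (1 - 6 / c + G q) = - c * ((1 - q) ^ 3 * s / (1 + q)\<^sup>2)"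
      by (simp only:)
    also have "\<dots> = - ((1 - q) ^ 3 * (c * q * s) / (q * (1 + q)\<^sup>2))"
      using q(1) by simp
    also have "\<dots> = eigenvalue_at q"
      unfolding q(3) eigenvalue_at_def by (simp add: eval_nat_numeral)
    finally show ?thesis by (simp only: q q_def)
  qed
  ultimately show ?thesis by (intro bexI[of _ "\<lambda>c. G (char_root n c)"]) auto
qed

theorem proposition4p1:
  shows
    "(\<forall>n\<ge>1. \<forall>c>0.
        (\<exists>!\<mu>. is_negative_eigenvalue n c \<mu>) \<and>
        (\<exists>!r. r \<in> {0<..<1} \<and> char_eq n c r) \<and>
        (\<forall>r\<in>{0<..<1}. char_eq n c r \<longrightarrow>
           neg_eigenvalue n c = - ((1 - r\<^sup>2) ^ 4 / (r\<^sup>2 * (1 + r\<^sup>2)\<^sup>2)))) \<and>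
     (\<forall>c>0. neg_eigenvalue 1 c = - (c ^ 4 / ((c + 1) * (c + 2)\<^sup>2))) \<and>
     (\<forall>n\<ge>2.
        (\<exists>g \<in> O[at_right 0](\<lambda>c::real. c\<^sup>2). \<forall>c>0.
           neg_eigenvalue n c =
             - (real n ^ 8 * c ^ 4 / 4) *
               (1 - 2 * real n * (4 * (real n)\<^sup>2 - 1) / 3 * c + g c)) \<and>
        (\<exists>g \<in> O[at_top](\<lambda>c::real. 1 / c\<^sup>2). \<forall>c>0.
           neg_eigenvalue n c = - c * (1 - 6 / c + g c)))"
proof (intro conjI allI impI ballI)
  fix n :: nat and c :: real
  assume n: "1 \<le> n" and c: "0 < c"
  show ex1: "\<exists>!r. r \<in> {0<..<1} \<and> char_eq n c r" using n c by (rule char_eq_ex1)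
  then obtain r where "r \<in> {0<..<1}" "char_eq n c r" by blast
  then show "\<exists>!\<mu>. is_negative_eigenvalue n c \<mu>"
    using neg_eigenvalue_eq(1)[OF n c] negative_eigenvalue_unique[OF n] by blast
next
  fix n :: nat and c r :: real
  assume "1 \<le> n" "0 < c" "r \<in> {0<..<1}" "char_eq n c r"
  then show "neg_eigenvalue n c = - ((1 - r\<^sup>2) ^ 4 / (r\<^sup>2 * (1 + r\<^sup>2)\<^sup>2))"
    using neg_eigenvalue_eq(2) by (simp add: eigenvalue_at_def)
next
  fix n :: nat
  assume "2 \<le> n"
  then have "1 \<le> n" by simp
  then show "\<exists>g\<in>O[at_right 0](\<lambda>c::real. c\<^sup>2). \<forall>c>0.
      neg_eigenvalue n c = - (real n ^ 8 * c ^ 4 / 4) *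
        (1 - 2 * real n * (4 * (real n)\<^sup>2 - 1) / 3 * c + g c)"
    by (rule neg_eigenvalue_weak_coupling)
qed (fact neg_eigenvalue_1 neg_eigenvalue_strong_coupling)+

end
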